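(* Let $X$ be a nontrivial finite-dimensional complex Banach space and let $L:X\to X$ be an invertible bounded linear operator with bounded inverse. Then $L$ has the topological shadowing property if and only if its spectrum satisfies $\sigma(L)\subset\mathbb{D}$ or $\sigma(L)\subset\mathbb{C}\setminus\overline{\mathbb{D}}$.
   Context: $\mathbb{D}$ is the open unit disk in $\mathbb{C}$ and $\overline{\mathbb{D}}$ its closure. The spectrum $\sigma(L)$ is the set of $\lambda\in\mathbb{C}$ such that $L-\lambda I$ is not invertible. "Nontrivial" means of positive dimension. For a metric space $Y$, $C^+(Y)$ denotes the set of all continuous functions $\delta:Y\to(0,\infty)$. Let $f:Y\to Y$ be a bijective map. For $\delta\in C^+(Y)$, a sequence $(x_n)_{n\in\mathbb{Z}}$ in $Y$ is a $\delta$-pseudo orbit of $f$ if $d(f(x_n),x_{n+1})<\delta(f(x_n))$ for all $n\in\mathbb{Z}$; it can be $\delta$-shadowed if there is $x\in Y$ such that $d(f^n(x),x_n)<\delta(f^n(x))$ for all $n\in\mathbb{Z}$. The map $f$ has the topological shadowing property if for every $\epsilon\in C^+(Y)$ there exists $\delta\in C^+(Y)$ such that every $\delta$-pseudo orbit of $f$ can be $\epsilon$-shadowed. A Banach space is regarded as a metric space with the metric induced by its norm. *)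

theory Defs
  imports "HOL-Analysis.Analysis"
begin

text \<open>
  A complex normed space is a real normed space together with a complex scalar multiplication
  that extends the real one and for which the norm is homogeneous.
\<close>

class complex_normed_vector = real_normed_vector +
  fixes scaleC :: "complex \<Rightarrow> 'a \<Rightarrow> 'a"  (infixr \<open>*\<^sub>C\<close> 75)
  assumes scaleC_add_right: "a *\<^sub>C (x + y) = a *\<^sub>C x + a *\<^sub>C y"
    and scaleC_add_left: "(a + b) *\<^sub>C x = a *\<^sub>C x + b *\<^sub>C x"
    and scaleC_scaleC: "a *\<^sub>C (b *\<^sub>C x) = (a * b) *\<^sub>C x"
    and scaleC_one: "1 *\<^sub>C x = x"
    and scaleC_of_real: "complex_of_real r *\<^sub>C x = r *\<^sub>R x"
    and norm_scaleC: "norm (a *\<^sub>C x) = cmod a * norm x"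

class complex_banach = complex_normed_vector + complete_space

subclass (in complex_banach) banach ..

instantiation complex :: complex_banach
begin

definition scaleC_complex :: "complex \<Rightarrow> complex \<Rightarrow> complex" where
  "scaleC_complex = (*)"

instance
  by standard
    (simp_all add: scaleC_complex_def algebra_simps norm_mult scaleR_conv_of_real)

end

global_interpretation complex_vector:
  vector_space "scaleC :: complex \<Rightarrow> 'a \<Rightarrow> 'a::complex_normed_vector"
  defines cspan = complex_vector.span
    and cdim = complex_vector.dim
  by standard (simp_all add: scaleC_add_right scaleC_add_left scaleC_scaleC scaleC_one)

definition bounded_clinear ::
  "('a::complex_normed_vector \<Rightarrow> 'b::complex_normed_vector) \<Rightarrow> bool" where
  "bounded_clinear T \<longleftrightarrow> Vector_Spaces.linear scaleC scaleC T \<and> bounded_linear T"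

text \<open>Invertibility in the algebra of bounded operators, i.e. with a bounded inverse.\<close>

definition invertible_op :: "('a::complex_normed_vector \<Rightarrow> 'a) \<Rightarrow> bool" where
  "invertible_op T \<longleftrightarrow>
     bounded_clinear T \<and> (\<exists>S. bounded_clinear S \<and> S \<circ> T = id \<and> T \<circ> S = id)"

definition spectrum :: "('a::complex_normed_vector \<Rightarrow> 'a) \<Rightarrow> complex set" where
  "spectrum T = {c. \<not> invertible_op (\<lambda>x. T x - c *\<^sub>C x)}"

definition pos_continuous :: "('a::metric_space \<Rightarrow> real) set" where
  "pos_continuous = {\<delta>. continuous_on UNIV \<delta> \<and> (\<forall>x. 0 < \<delta> x)}"

text \<open>
  Integer iterates. These, and the notions below, are meant for bijective maps only;
  otherwise the negative iterates are meaningless.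
\<close>

definition iter_int :: "('a \<Rightarrow> 'a) \<Rightarrow> int \<Rightarrow> 'a \<Rightarrow> 'a" where
  "iter_int f n = (if 0 \<le> n then f ^^ nat n else inv f ^^ nat (- n))"

definition pseudo_orbit ::
  "('a::metric_space \<Rightarrow> 'a) \<Rightarrow> ('a \<Rightarrow> real) \<Rightarrow> (int \<Rightarrow> 'a) \<Rightarrow> bool" where
  "pseudo_orbit f \<delta> x \<longleftrightarrow> (\<forall>n. dist (f (x n)) (x (n + 1)) < \<delta> (f (x n)))"

definition shadowed ::
  "('a::metric_space \<Rightarrow> 'a) \<Rightarrow> ('a \<Rightarrow> real) \<Rightarrow> (int \<Rightarrow> 'a) \<Rightarrow> bool" where
  "shadowed f \<epsilon> x \<longleftrightarrow> (\<exists>y. \<forall>n. dist (iter_int f n y) (x n) < \<epsilon> (iter_int f n y))"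

definition topological_shadowing :: "('a::metric_space \<Rightarrow> 'a) \<Rightarrow> bool" where
  "topological_shadowing f \<longleftrightarrow>
     (\<forall>\<epsilon>\<in>pos_continuous. \<exists>\<delta>\<in>pos_continuous.
        \<forall>x. pseudo_orbit f \<delta> x \<longrightarrow> shadowed f \<epsilon> x)"

end

theory Submission
  imports Defs "HOL-Computational_Algebra.Fundamental_Theorem_Algebra" "HOL-Real_Asymp.Real_Asymp"
begin

text \<open>
  In finite dimension some product $(L - c_1) \cdots (L - c_m)$ vanishes, and the factors whose
  root is not an eigenvalue can be cancelled. Such an annihilating product replaces Jordan normal
  forms throughout: it shows that the spectrum consists of eigenvalues, it yields adapted norms
  (\<open>adapted_norm_exists\<close>), and it controls bounded orbits (\<open>bounded_orbit_peripheral\<close>).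

  Sufficiency. If the spectrum lies in the open disk, the space has an equivalent norm \<open>N\<close> in
  which \<open>L\<close> is a strict contraction. Write the pseudo orbit as $u_{n+1} = L u_n + d_{n+1}$. The
  correction $e_n = \sum_j L^j d_{n-j}$ collects the errors of the past, and $u_n - e_n$ is a true
  orbit. Since $L$ contracts, a pseudo orbit is farther out in the past than at present, up to a
  bounded threshold. Hence if the allowed error decreases with the norm, every $d_{n-j}$ is at most
  the error allowed at time $n$, and the geometric series bounds $e_n$ by a multiple of it
  (\<open>orbit_near_sequence\<close>). As balls are compact, every positive continuous function
  dominates such a radially decreasing one (\<open>radial_minorant\<close>). If the spectrum lies outside
  the closed disk, the same argument applies to $L^{-1}$ and the pseudo orbit run backwards.

  Necessity. Otherwise there are eigenvalues $a$, $b$ with $|a| \ge 1 \ge |b|$. If one of them has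
  modulus one, a pseudo orbit can start at rest at the origin and drift, by small steps, along the
  eigenvector to a prescribed distance. A true orbit cannot follow it: the product of the factors
  with other roots maps a bounded orbit to one of constant norm
  (\<open>neutral_eigenvalue_no_shadowing\<close>). If $|a| > 1 > |b|$, consider the tolerance
  $\exp(-\|x\|)$ and a pseudo orbit that comes in from infinity along the eigenvector of $b$ and
  then makes a single jump along the eigenvector of $a$. The tolerance decays so fast along the
  incoming branch that only the orbit of that branch itself can shadow it, and this orbit misses
  the outgoing branch (\<open>saddle_no_shadowing\<close>).
\<close>

section \<open>Complex linear operators\<close>

lemma bounded_clinear_add: "bounded_clinear T \<Longrightarrow> T (x + y) = T x + T y"
  and bounded_clinear_diff: "bounded_clinear T \<Longrightarrow> T (x - y) = T x - T y"
  and bounded_clinear_zero: "bounded_clinear T \<Longrightarrow> T 0 = 0"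
  and bounded_clinear_minus: "bounded_clinear T \<Longrightarrow> T (- x) = - T x"
  unfolding bounded_clinear_def
  by (simp_all add: linear_simps)

lemma bounded_clinear_scale: "bounded_clinear T \<Longrightarrow> T (c *\<^sub>C x) = c *\<^sub>C T x"
  unfolding bounded_clinear_def Vector_Spaces.linear_iff by blast

lemmas bounded_clinear_simps =
  bounded_clinear_add bounded_clinear_diff bounded_clinear_zero bounded_clinear_minus
  bounded_clinear_scale

lemma bounded_clinear_imp_bounded_linear: "bounded_clinear T \<Longrightarrow> bounded_linear T"
  by (simp add: bounded_clinear_def)

lemma bounded_clinearI:
  assumes "bounded_linear T" and "\<And>c x. T (c *\<^sub>C x) = c *\<^sub>C T x"
  shows "bounded_clinear T"
  unfolding bounded_clinear_def Vector_Spaces.linear_iff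
  using assms complex_vector.vector_space_axioms[where 'a = 'a]
    complex_vector.vector_space_axioms[where 'a = 'b]
  by (auto simp: linear_simps)

lemma bounded_linear_scaleC: "bounded_linear ((*\<^sub>C) c)"
  by (rule bounded_linear_intro[where K = "cmod c"])
    (simp_all add: scaleC_add_right scaleC_scaleC norm_scaleC mult.commute
      flip: scaleC_of_real)

lemma bounded_linear_scaleC_left: "bounded_linear (\<lambda>c. c *\<^sub>C x)"
  by (rule bounded_linear_intro[where K = "norm x"])
    (simp_all add: scaleC_add_left scaleC_scaleC norm_scaleC scaleR_conv_of_real
      flip: scaleC_of_real)

lemmas scaleC_simps =
  complex_vector.scale_right_diff_distrib complex_vector.scale_left_diff_distrib
  scaleC_add_left scaleC_add_right scaleC_scaleC scaleC_one norm_scaleC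

lemma bounded_clinear_id: "bounded_clinear (\<lambda>x. x)"
  by (rule bounded_clinearI) (auto intro: bounded_linear_ident)

lemma bounded_clinear_compose:
  assumes "bounded_clinear S" "bounded_clinear T"
  shows "bounded_clinear (\<lambda>x. S (T x))"
  using assms
  by (intro bounded_clinearI)
    (auto simp: bounded_clinear_simps
      intro: bounded_linear_compose bounded_clinear_imp_bounded_linear)

lemma bounded_clinear_sub_scale:
  assumes "bounded_clinear S" "bounded_clinear T"
  shows "bounded_clinear (\<lambda>x. S x - c *\<^sub>C T x)"
proof (rule bounded_clinearI)
  show "bounded_linear (\<lambda>x. S x - c *\<^sub>C T x)"
    by (intro bounded_linear_sub bounded_linear_compose[OF bounded_linear_scaleC]
        bounded_clinear_imp_bounded_linear assms)
qed (simp add: bounded_clinear_scale[OF assms(1)] bounded_clinear_scale[OF assms(2)]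
    scaleC_simps mult.commute)

lemma invertible_opE:
  assumes "invertible_op T"
  obtains S where "bounded_clinear T" "bounded_clinear S" "\<And>x. S (T x) = x" "\<And>x. T (S x) = x"
  using assms unfolding invertible_op_def by (metis comp_apply id_apply)

lemma eigenvalue_in_spectrum:
  assumes "T v = c *\<^sub>C v" "v \<noteq> 0"
  shows "c \<in> spectrum T"
proof (rule ccontr)
  assume "c \<notin> spectrum T"
  then have "invertible_op (\<lambda>x. T x - c *\<^sub>C x)" by (simp add: spectrum_def)
  then obtain S where "bounded_clinear S" "\<And>x. S (T x - c *\<^sub>C x) = x"
    by (rule invertible_opE) auto
  with assms show False by (metis bounded_clinear_zero right_minus_eq)
qed

section \<open>Products of linear factors of an operator\<close>

primrec lin_factors ::
  "('a::complex_normed_vector \<Rightarrow> 'a) \<Rightarrow> complex list \<Rightarrow> 'a \<Rightarrow> 'a" where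
  "lin_factors T [] x = x"
| "lin_factors T (c # cs) x = lin_factors T cs (T x - c *\<^sub>C x)"

lemma lin_factors_append: "lin_factors T (cs @ ds) x = lin_factors T ds (lin_factors T cs x)"
  by (induction cs arbitrary: x) auto

lemma bounded_clinear_lin_factors:
  assumes "bounded_clinear T"
  shows "bounded_clinear (lin_factors T cs)"
proof (induction cs)
  case Nil
  then show ?case by (simp add: bounded_clinear_id)
next
  case (Cons c cs)
  show ?case
    using bounded_clinear_compose[OF Cons.IH
        bounded_clinear_sub_scale[OF assms bounded_clinear_id, of c]]
    by simp
qed

lemma lin_factors_commute:
  assumes "bounded_clinear S" "\<And>x. S (T x) = T (S x)"
  shows "S (lin_factors T cs x) = lin_factors T cs (S x)"
  by (induction cs arbitrary: x) (simp_all add: assms bounded_clinear_simps[OF assms(1)])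

lemma lin_factors_eigenvector:
  assumes "bounded_clinear T" "T v = a *\<^sub>C v"
  shows "lin_factors T cs v = (\<Prod>c\<leftarrow>cs. a - c) *\<^sub>C v"
proof (induction cs)
  case Nil
  then show ?case by (simp add: scaleC_simps)
next
  case (Cons c cs)
  have "lin_factors T (c # cs) v = lin_factors T cs ((a - c) *\<^sub>C v)"
    by (simp add: assms(2) scaleC_simps)
  then show ?case
    by (simp only: bounded_clinear_scale[OF bounded_clinear_lin_factors[OF assms(1)]] Cons
        scaleC_scaleC list.map prod_list.Cons)
qed

text \<open>
  A factor \<open>T - c\<close> with trivial kernel can be cancelled from a product that vanishes at \<open>x\<close>.
  The predicate \<open>P\<close> marks the factors that are kept.
\<close>

lemma lin_factors_filter_eq_0:
  assumes T: "bounded_clinear T"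
    and inj: "\<And>c x. c \<in> set cs \<Longrightarrow> \<not> P c \<Longrightarrow> T x = c *\<^sub>C x \<Longrightarrow> x = 0"
    and "lin_factors T cs x = 0"
  shows "lin_factors T (filter P cs) x = 0"
  using inj assms(3)
proof (induction cs arbitrary: x)
  case (Cons c cs)
  let ?F = "lin_factors T (filter P cs)"
  have F: "bounded_clinear ?F" by (rule bounded_clinear_lin_factors[OF T])
  have "?F (T x - c *\<^sub>C x) = 0"
    using Cons by auto
  then have "T (?F x) = c *\<^sub>C ?F x"
    using lin_factors_commute[OF T, of T "filter P cs" x]
    by (simp add: bounded_clinear_simps[OF F])
  then show ?case
    using Cons.prems(1)[of c "?F x"] \<open>?F (T x - c *\<^sub>C x) = 0\<close> by auto
qed simp

text \<open>
  Division with remainder of the polynomial $\prod (z - d)$ by $z - c$, with the operator \<open>T\<close>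
  inserted for $z$. The quotient \<open>Q\<close> is a polynomial in \<open>T\<close>, hence bounded and commuting
  with \<open>T\<close>.
\<close>

lemma lin_factors_division:
  assumes T: "bounded_clinear T"
  shows "\<exists>Q. bounded_clinear Q \<and> (\<forall>x. Q (T x) = T (Q x)) \<and>
    (\<forall>x. lin_factors T cs x = (\<Prod>d\<leftarrow>cs. c - d) *\<^sub>C x + (T (Q x) - c *\<^sub>C Q x))"
proof (induction cs)
  case Nil
  show ?case
    by (rule exI[of _ "\<lambda>x. 0"])
      (auto simp: scaleC_simps bounded_clinear_simps[OF T] intro!: bounded_clinearI)
next
  case (Cons d cs)
  then obtain Q where Q: "bounded_clinear Q" "\<And>x. Q (T x) = T (Q x)"
    "\<And>x. lin_factors T cs x = (\<Prod>d\<leftarrow>cs. c - d) *\<^sub>C x + (T (Q x) - c *\<^sub>C Q x)"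
    by blast
  let ?k = "\<Prod>d\<leftarrow>cs. c - d"
  let ?R = "\<lambda>x. Q (T x - d *\<^sub>C x) - (- ?k) *\<^sub>C x"
  have "bounded_clinear ?R"
    by (intro bounded_clinear_sub_scale bounded_clinear_compose[OF Q(1)] T bounded_clinear_id)
  moreover have "?R (T x) = T (?R x)" for x
    by (simp add: Q(2) bounded_clinear_simps[OF T] bounded_clinear_simps[OF Q(1)])
  moreover have "lin_factors T (d # cs) x
      = (\<Prod>d\<leftarrow>d # cs. c - d) *\<^sub>C x + (T (?R x) - c *\<^sub>C ?R x)" for x
    by (simp add: Q(2,3) bounded_clinear_simps[OF T] bounded_clinear_simps[OF Q(1)] scaleC_simps
        algebra_simps)
  ultimately show ?case by blast
qed

text \<open>
  If $T - c$ is injective, all factors with root $c$ can be cancelled from the annihilating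
  product. Dividing the rest by $z - c$ leaves a nonzero remainder, so the quotient is, up to that
  scalar, an inverse of $T - c$, and it is bounded because it is a polynomial in $T$.
\<close>

lemma spectrum_imp_eigenvalue:
  assumes T: "bounded_clinear T" and ann: "\<And>x. lin_factors T cs x = 0"
    and c: "c \<in> spectrum T"
  obtains v where "v \<noteq> 0" "T v = c *\<^sub>C v"
proof (rule ccontr)
  assume "\<not> thesis"
  with that have inj: "\<And>v. T v = c *\<^sub>C v \<Longrightarrow> v = 0" by blast
  let ?ds = "filter (\<lambda>d. d \<noteq> c) cs"
  have ann': "lin_factors T ?ds x = 0" for x
    by (rule lin_factors_filter_eq_0[OF T _ ann]) (use inj in auto)
  let ?k = "\<Prod>d\<leftarrow>?ds. c - d"
  obtain Q where Q: "bounded_clinear Q" "\<And>x. Q (T x) = T (Q x)"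
    "\<And>x. lin_factors T ?ds x = ?k *\<^sub>C x + (T (Q x) - c *\<^sub>C Q x)"
    using lin_factors_division[OF T] by blast
  have k: "?k \<noteq> 0" by (auto simp: prod_list_zero_iff)
  let ?S = "\<lambda>x. 0 - inverse ?k *\<^sub>C Q x"
  have eq: "T (Q x) - c *\<^sub>C Q x = - (?k *\<^sub>C x)" for x
    using ann'[of x] unfolding Q(3) by (metis add.inverse_unique add.commute)
  have S: "bounded_clinear ?S"
    by (intro bounded_clinear_sub_scale Q(1)) (auto intro!: bounded_clinearI)
  have 1: "T (?S x) - c *\<^sub>C ?S x = x" for x
  proof -
    have "T (?S x) - c *\<^sub>C ?S x = - (inverse ?k *\<^sub>C (T (Q x) - c *\<^sub>C Q x))"
      by (simp add: bounded_clinear_simps[OF T] scaleC_simps mult.commute)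
    also have "\<dots> = x" unfolding eq using k by (simp add: scaleC_simps)
    finally show ?thesis .
  qed
  have 2: "?S (T x - c *\<^sub>C x) = x" for x
    using 1[of x] bounded_clinear_simps[OF Q(1)] bounded_clinear_simps[OF T] Q(2)
    by (simp add: scaleC_simps mult.commute)
  have "invertible_op (\<lambda>x. T x - c *\<^sub>C x)"
    unfolding invertible_op_def
    using S 1 2 bounded_clinear_sub_scale[OF T bounded_clinear_id, of c]
    by (intro conjI exI[of _ ?S]) (auto simp: fun_eq_iff)
  with c show False by (simp add: spectrum_def)
qed

section \<open>An annihilating product in finite dimension\<close>

definition poly_op :: "('a::complex_normed_vector \<Rightarrow> 'a) \<Rightarrow> complex poly \<Rightarrow> 'a \<Rightarrow> 'a" where
  "poly_op T p x = fold_coeffs (\<lambda>a y. a *\<^sub>C x + T y) p 0"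

lemma poly_op_0: "poly_op T 0 x = 0"
  by (simp add: poly_op_def)

lemma poly_op_pCons:
  assumes "bounded_clinear T"
  shows "poly_op T (pCons a p) x = a *\<^sub>C x + T (poly_op T p x)"
  by (cases "p = 0 \<and> a = 0")
    (auto simp: poly_op_def fold_coeffs_pCons_not_0_0_eq bounded_clinear_simps[OF assms]
      fold_coeffs_pCons_coeff_not_0_eq)

lemma poly_op_add:
  assumes T: "bounded_clinear T"
  shows "poly_op T (p + q) x = poly_op T p x + poly_op T q x"
  by (induction p q rule: poly_induct2)
    (simp_all add: poly_op_0 poly_op_pCons[OF T] bounded_clinear_simps[OF T] scaleC_simps)

lemma poly_op_smult:
  assumes T: "bounded_clinear T"
  shows "poly_op T (smult c p) x = c *\<^sub>C poly_op T p x"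
  by (induction p)
    (simp_all add: poly_op_0 poly_op_pCons[OF T] bounded_clinear_simps[OF T] scaleC_simps)

lemma poly_op_monom:
  assumes T: "bounded_clinear T"
  shows "poly_op T (monom 1 k) x = (T ^^ k) x"
  by (induction k)
    (simp_all add: poly_op_0 poly_op_pCons[OF T] bounded_clinear_simps[OF T] scaleC_simps
      monom_0 monom_Suc)

lemma poly_op_linear_factor:
  assumes T: "bounded_clinear T"
  shows "poly_op T ([:- c, 1:] * q) x = T (poly_op T q x) - c *\<^sub>C poly_op T q x"
  by (simp add: poly_op_add[OF T] poly_op_smult[OF T] poly_op_pCons[OF T] scaleC_simps
      del: smult_minus_left)

text \<open>
  The fundamental theorem of algebra, applied to a polynomial that annihilates \<open>x\<close>.
\<close>

lemma poly_op_eq_0_imp_lin_factors: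
  assumes T: "bounded_clinear T" and "p \<noteq> 0" "poly_op T p x = 0"
  shows "\<exists>cs. lin_factors T cs x = 0"
  using assms(2,3)
proof (induction "degree p" arbitrary: p x)
  case 0
  then obtain a where "p = [:a:]" "a \<noteq> 0"
    by (metis degree_eq_zeroE pCons_0_0)
  with 0 show ?case
    by (intro exI[of _ "[]"])
      (auto simp: poly_op_pCons[OF T] poly_op_0 bounded_clinear_simps[OF T])
next
  case (Suc n)
  then obtain c where "poly p c = 0"
    using fundamental_theorem_of_algebra[of p] by (auto simp: constant_degree)
  then obtain q where q: "p = [:- c, 1:] * q"
    by (metis poly_eq_0_iff_dvd dvdE)
  with Suc.prems have "q \<noteq> 0" by auto
  moreover have "degree q = n"
    using Suc.hyps(2) \<open>q \<noteq> 0\<close> unfolding q by (subst (asm) degree_mult_eq) auto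
  moreover have "poly_op T q (T x - c *\<^sub>C x) = poly_op T p x"
  proof -
    have "poly_op T q (T x - c *\<^sub>C x) = T (poly_op T q x) - c *\<^sub>C poly_op T q x"
      by (induction q)
        (simp_all add: poly_op_0 poly_op_pCons[OF T] bounded_clinear_simps[OF T] scaleC_simps
          mult.commute)
    then show ?thesis unfolding q poly_op_linear_factor[OF T] by simp
  qed
  ultimately obtain cs where "lin_factors T cs (T x - c *\<^sub>C x) = 0"
    using Suc.hyps(1)[of q "T x - c *\<^sub>C x"] Suc.prems by auto
  then show ?case by (intro exI[of _ "c # cs"]) simp
qed

text \<open>
  The iterates of \<open>x\<close> cannot all be linearly independent. The first iterate that depends on its
  predecessors gives a monic polynomial in \<open>T\<close> that kills \<open>x\<close>.
\<close>

lemma lin_factors_annihilates_vector: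
  fixes T :: "'a::complex_normed_vector \<Rightarrow> 'a"
  assumes T: "bounded_clinear T" and B: "finite B" "cspan B = (UNIV :: 'a set)"
  shows "\<exists>cs. lin_factors T cs x = 0"
proof -
  define V where "V k = (\<lambda>i. (T ^^ i) x) ` {..<k}" for k :: nat
  have "\<exists>k. (T ^^ k) x \<in> cspan (V k)"
  proof (rule ccontr)
    assume neg: "\<not> ?thesis"
    have "complex_vector.independent (V k) \<and> card (V k) = k" for k
    proof (induction k)
      case 0
      then show ?case by (simp add: V_def complex_vector.independent_empty)
    next
      case (Suc k)
      have V: "V (Suc k) = insert ((T ^^ k) x) (V k)"
        by (simp add: V_def lessThan_Suc)
      have "(T ^^ k) x \<notin> V k" using neg complex_vector.span_base by blast
      then show ?case
        using Suc neg unfolding V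
        by (auto simp: complex_vector.independent_insert card_insert_if V_def)
    qed
    from complex_vector.independent_span_bound[OF B(1), of "V (Suc (card B))"] this
    show False by (metis B(2) Suc_n_not_le_n subset_UNIV)
  qed
  then obtain k where k: "(T ^^ k) x \<in> cspan (V k)" by blast
  let ?W = "{poly_op T p x | p. \<forall>i\<ge>k. coeff p i = 0}"
  have "complex_vector.subspace ?W"
    unfolding complex_vector.subspace_def
  proof (intro conjI ballI allI)
    have "0 = poly_op T 0 x \<and> (\<forall>i\<ge>k. coeff (0::complex poly) i = 0)"
      by (simp add: poly_op_0)
    then show "0 \<in> ?W" by blast
  next
    fix y z assume "y \<in> ?W" "z \<in> ?W"
    then obtain p q where "y = poly_op T p x" "z = poly_op T q x"
      "\<forall>i\<ge>k. coeff p i = 0" "\<forall>i\<ge>k. coeff q i = 0" by blast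
    then have "y + z = poly_op T (p + q) x" "\<forall>i\<ge>k. coeff (p + q) i = 0"
      by (auto simp: poly_op_add[OF T])
    then show "y + z \<in> ?W" by blast
  next
    fix c y assume "y \<in> ?W"
    then obtain p where "y = poly_op T p x" "\<forall>i\<ge>k. coeff p i = 0" by blast
    then have "c *\<^sub>C y = poly_op T (smult c p) x" "\<forall>i\<ge>k. coeff (smult c p) i = 0"
      by (auto simp: poly_op_smult[OF T])
    then show "c *\<^sub>C y \<in> ?W" by blast
  qed
  moreover have "V k \<subseteq> ?W"
  proof
    fix y assume "y \<in> V k"
    then obtain i where "i < k" "y = (T ^^ i) x" by (auto simp: V_def)
    then have "y = poly_op T (monom 1 i) x \<and> (\<forall>j\<ge>k. coeff (monom (1::complex) i) j = 0)"
      by (auto simp: poly_op_monom[OF T])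
    then show "y \<in> ?W" by blast
  qed
  ultimately have "(T ^^ k) x \<in> ?W" using k complex_vector.span_minimal by blast
  then obtain p where p: "(T ^^ k) x = poly_op T p x" "\<forall>i\<ge>k. coeff p i = 0" by blast
  let ?p = "monom 1 k + smult (- 1) p"
  have "coeff ?p k \<noteq> 0" using p by simp
  then have "?p \<noteq> 0" by (metis coeff_0)
  moreover have "poly_op T ?p x = 0"
    unfolding poly_op_add[OF T] poly_op_smult[OF T] poly_op_monom[OF T] p(1)
    by (simp add: scaleC_simps)
  ultimately show ?thesis by (rule poly_op_eq_0_imp_lin_factors[OF T])
qed

lemma lin_factors_annihilates:
  fixes T :: "'a::complex_normed_vector \<Rightarrow> 'a"
  assumes T: "bounded_clinear T" and B: "finite B" "cspan B = (UNIV :: 'a set)"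
  shows "\<exists>cs. \<forall>x. lin_factors T cs x = 0"
proof -
  have "\<exists>cs. \<forall>b\<in>A. lin_factors T cs b = 0" if "finite A" for A
    using that
  proof (induction A rule: finite_induct)
    case (insert a A)
    obtain cs where cs: "\<forall>b\<in>A. lin_factors T cs b = 0" using insert by blast
    obtain ds where ds: "lin_factors T ds a = 0"
      using lin_factors_annihilates_vector[OF T B] by blast
    note F = bounded_clinear_lin_factors[OF T]
    have comm: "lin_factors T cs (lin_factors T ds y) = lin_factors T ds (lin_factors T cs y)" for y
      by (rule lin_factors_commute[OF F])
        (rule lin_factors_commute[OF T, symmetric], rule refl)
    have "lin_factors T (cs @ ds) b = 0" if "b \<in> insert a A" for b
      using that cs ds comm[of b] bounded_clinear_zero[OF F] by (auto simp: lin_factors_append)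
    then show ?case by blast
  qed simp
  with B obtain cs where cs: "\<forall>b\<in>B. lin_factors T cs b = 0" by blast
  have "complex_vector.subspace {x. lin_factors T cs x = 0}"
    unfolding complex_vector.subspace_def
    by (simp add: bounded_clinear_simps[OF bounded_clinear_lin_factors[OF T]])
  then have "cspan B \<subseteq> {x. lin_factors T cs x = 0}"
    using cs by (intro complex_vector.span_minimal) auto
  with B show ?thesis by blast
qed

section \<open>Compact balls and radial minorants\<close>

text \<open>
  The Heine--Borel property, by induction on the spanning set. By the induction hypothesis the
  span \<open>V\<close> of the smaller set is closed, so a new vector \<open>b\<close> has positive distance
  \<open>d\<close> from it. Then \<open>\<bar>k\<bar> d \<le> \<parallel>k b + v\<parallel>\<close> bounds the coordinate along \<open>b\<close>, and the
  ball is covered by the image of a compact product under addition.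
\<close>

lemma compact_cspan_cball:
  fixes B :: "'a::complex_normed_vector set"
  assumes "finite B"
  shows "compact (cspan B \<inter> cball 0 R)"
  using assms
proof (induction B arbitrary: R rule: finite_induct)
  case empty
  show ?case by (intro finite_imp_compact) simp
next
  case (insert b B)
  let ?V = "cspan B"
  show ?case
  proof (cases "b \<in> ?V \<or> R < 0")
    case True
    then show ?thesis
      using insert.IH by (auto simp: complex_vector.span_redundant)
  next
    case False
    then have b: "b \<notin> ?V" and R: "0 \<le> R" by auto
    have "closed ?V"
      unfolding closed_limpt
    proof (intro allI impI)
      fix x assume "x islimpt ?V"
      then have "x islimpt ?V \<inter> ball x 1"
        unfolding islimpt_def
        by (metis Int_iff centre_in_ball open_Int open_ball zero_less_one)
      moreover have "?V \<inter> ball x 1 \<subseteq> ?V \<inter> cball 0 (norm x + 1)"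
      proof
        fix y assume "y \<in> ?V \<inter> ball x 1"
        then have "y \<in> ?V" "norm (x - y) < 1" by (auto simp: dist_norm)
        then show "y \<in> ?V \<inter> cball 0 (norm x + 1)"
          using norm_triangle_ineq4[of x "x - y"] by simp
      qed
      ultimately have "x islimpt ?V \<inter> cball 0 (norm x + 1)" by (rule islimpt_subset)
      then show "x \<in> ?V"
        using insert.IH[THEN compact_imp_closed] by (auto simp: closed_limpt)
    qed
    define d where "d = infdist b ?V"
    have V0: "0 \<in> ?V" by (rule complex_vector.span_zero)
    have d: "0 < d"
      using b \<open>closed ?V\<close> in_closed_iff_infdist_zero[of ?V b] V0 infdist_nonneg[of b ?V]
      unfolding d_def by fastforce
    let ?C = "cball (0::complex) (R / d) \<times> (?V \<inter> cball 0 (R + R / d * norm b))"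
    let ?f = "\<lambda>(z, v). z *\<^sub>C b + v"
    have "compact (?f ` ?C)"
      unfolding case_prod_unfold
      by (intro compact_continuous_image compact_Times compact_cball insert.IH continuous_intros
          bounded_linear.continuous_on[OF bounded_linear_scaleC_left])
    moreover have "cspan (insert b B) \<inter> cball 0 R = ?f ` ?C \<inter> cball 0 R"
    proof (intro equalityI subsetI)
      fix x assume "x \<in> cspan (insert b B) \<inter> cball 0 R"
      then obtain k where k: "x - k *\<^sub>C b \<in> ?V" and x: "norm x \<le> R"
        by (auto simp: complex_vector.span_breakdown_eq)
      have "cmod k * d \<le> norm x"
      proof (cases "k = 0")
        case False
        have "inverse (- k) *\<^sub>C (x - k *\<^sub>C b) \<in> ?V" using k by (rule complex_vector.span_scale)
        then have "d \<le> dist b (inverse (- k) *\<^sub>C (x - k *\<^sub>C b))"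
          unfolding d_def by (rule infdist_le)
        also have "\<dots> = norm x / cmod k"
          using False by (simp add: dist_norm scaleC_simps norm_inverse norm_divide field_simps)
        finally show ?thesis using False by (simp add: field_simps)
      qed simp
      with x d have kR: "cmod k \<le> R / d" by (simp add: field_simps)
      have "norm (x - k *\<^sub>C b) \<le> R + R / d * norm b"
        using norm_triangle_ineq4[of x "k *\<^sub>C b"] x mult_right_mono[OF kR, of "norm b"]
        by (simp add: norm_scaleC)
      then have "x = ?f (k, x - k *\<^sub>C b)" "(k, x - k *\<^sub>C b) \<in> ?C" using k kR by auto
      then show "x \<in> ?f ` ?C \<inter> cball 0 R" using x by (metis IntI image_eqI mem_cball_0)
    next
      fix x assume "x \<in> ?f ` ?C \<inter> cball 0 R"
      then obtain z v where "x = z *\<^sub>C b + v" "v \<in> ?V" "norm x \<le> R" by auto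
      then show "x \<in> cspan (insert b B) \<inter> cball 0 R"
        by (auto simp: complex_vector.span_breakdown_eq intro!: exI[of _ z])
    qed
    ultimately show ?thesis by (metis compact_Int_closed closed_cball)
  qed
qed

text \<open>
  The function $g(t) = \inf_y \,(\epsilon(y) + \max(0, \|y\| - t))$ is decreasing and 1-Lipschitz
  in $t$, and below $\epsilon(y)$ whenever $\|y\| \le t$. It is positive because points with
  $\|y\| > t + 1$ contribute at least 1, while the others lie in a compact ball. The shift of the
  argument by 1 leaves room for replacing a point by another one at distance at most 1, and the
  cut-off at 1/2 keeps the errors below that distance.
\<close>

lemma radial_minorant:
  fixes \<epsilon> :: "'a::real_normed_vector \<Rightarrow> real"
  assumes cpt: "\<And>R. compact (cball (0::'a) R)" and \<epsilon>: "\<epsilon> \<in> pos_continuous"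
  obtains G where "continuous_on UNIV G" "antimono G" "\<And>t. 0 < G t" "\<And>t. G t \<le> 1 / 2"
    "\<And>t y. norm y \<le> t + 1 \<Longrightarrow> G t < \<epsilon> y"
proof -
  have cont: "continuous_on UNIV \<epsilon>" and pos: "0 < \<epsilon> y" for y
    using \<epsilon> by (auto simp: pos_continuous_def)
  define h where "h t y = \<epsilon> y + max 0 (norm y - t)" for t y
  define g where "g t = (INF y. h t y)" for t
  have bdd: "bdd_below (range (h t))" for t
    by (rule bdd_belowI[of _ 0]) (auto simp: h_def intro: add_nonneg_nonneg less_imp_le[OF pos])
  have g_le: "g t \<le> h t y" for t y
    unfolding g_def by (rule cINF_lower[OF bdd]) simp
  have g_ge: "c \<le> g t" if "\<And>y. c \<le> h t y" for c t
    unfolding g_def by (rule cINF_greatest) (use that in auto)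
  have lip: "g t - \<bar>s - t\<bar> \<le> g s" for s t
  proof (rule g_ge)
    fix y show "g t - \<bar>s - t\<bar> \<le> h s y" using g_le[of t y] by (auto simp: h_def)
  qed
  have mono: "g t \<le> g s" if "s \<le> t" for s t
  proof (rule g_ge)
    fix y show "g t \<le> h s y" using g_le[of t y] that by (auto simp: h_def)
  qed
  have g_pos: "0 < g t" for t
  proof -
    obtain m where m: "0 < m" "\<And>y. norm y \<le> t + 1 \<Longrightarrow> m \<le> \<epsilon> y"
    proof (cases "cball (0::'a) (t + 1) = {}")
      case True
      then have "\<not> norm (y::'a) \<le> t + 1" for y by (auto simp: set_eq_iff)
      then show ?thesis using that[of 1] by auto
    next
      case False
      then obtain x where "\<forall>y\<in>cball 0 (t + 1). \<epsilon> x \<le> \<epsilon> y"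
        using continuous_attains_inf[OF cpt False continuous_on_subset[OF cont]] by auto
      then show ?thesis using that[of "\<epsilon> x"] pos by auto
    qed
    have "min m 1 \<le> g t"
    proof (rule g_ge)
      fix y show "min m 1 \<le> h t y"
        using m(2)[of y] pos[of y] unfolding h_def by (cases "norm y \<le> t + 1") (linarith, linarith)
    qed
    with m(1) show ?thesis by linarith
  qed
  have "continuous_on UNIV g"
    unfolding continuous_on_iff
  proof (intro ballI allI impI)
    fix t e :: real assume "0 < e"
    moreover have "dist (g s) (g t) \<le> dist s t" for s
      using lip[of s t] lip[of t s] by (simp add: dist_real_def abs_le_iff abs_minus_commute)
    ultimately show "\<exists>d>0. \<forall>s\<in>UNIV. dist s t < d \<longrightarrow> dist (g s) (g t) < e"
      by (meson le_less_trans)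
  qed
  then have contG: "continuous_on UNIV (\<lambda>t. min 1 (g (t + 1)) / 2)"
    by (auto intro!: continuous_intros continuous_on_compose2[of UNIV g])
  show ?thesis
  proof (rule that[OF contG])
    show "antimono (\<lambda>t. min 1 (g (t + 1)) / 2)"
      by (intro antimonoI divide_right_mono min.mono mono) auto
    show "0 < min 1 (g (t + 1)) / 2" "min 1 (g (t + 1)) / 2 \<le> 1 / 2" for t
      using g_pos[of "t + 1"] by auto
    show "min 1 (g (t + 1)) / 2 < \<epsilon> y" if "norm y \<le> t + 1" for t y
      using g_le[of "t + 1" y] pos[of y] g_pos[of "t + 1"] that by (auto simp: h_def)
  qed
qed

section \<open>Norms adapted to a contraction\<close>

locale adapted_norm =
  fixes T :: "'a::banach \<Rightarrow> 'a" and N :: "'a \<Rightarrow> real" and lam K :: real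
  assumes bounded_linear_T: "bounded_linear T"
    and lam_nonneg: "0 \<le> lam" and lam_less_1: "lam < 1" and K_pos: "0 < K"
    and N_triangle: "N (x + y) \<le> N x + N y"
    and norm_le_N: "norm x \<le> N x"
    and N_le_norm: "N x \<le> K * norm x"
    and N_contracts: "N (T x) \<le> lam * N x"

text \<open>
  With $x_0 = x$ and $x_{i+1} = (T - c_{i+1}) x_i$, this is $\sum_i a^i \|x_i\|$, summed over
  $i < m$ where $m$ is the number of roots. For large $a$ a vector counts little compared with its
  images under the factors, so that the off-diagonal part of $T$, which maps $x_i$ to $x_{i+1}$,
  has small norm.
\<close>

primrec flag_norm ::
  "('a::complex_normed_vector \<Rightarrow> 'a) \<Rightarrow> real \<Rightarrow> complex list \<Rightarrow> 'a \<Rightarrow> real" where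
  "flag_norm T a [] x = 0"
| "flag_norm T a (c # cs) x = norm x + a * flag_norm T a cs (T x - c *\<^sub>C x)"

lemma flag_norm_nonneg: "0 \<le> a \<Longrightarrow> 0 \<le> flag_norm T a cs x"
  by (induction cs arbitrary: x) auto

lemma norm_le_flag_norm:
  assumes "0 \<le> a" "lin_factors T cs x = 0"
  shows "norm x \<le> flag_norm T a cs x"
  using assms by (cases cs) (auto intro: mult_nonneg_nonneg flag_norm_nonneg)

lemma flag_norm_triangle:
  assumes T: "bounded_clinear T" and a: "0 \<le> a"
  shows "flag_norm T a cs (x + y) \<le> flag_norm T a cs x + flag_norm T a cs y"
proof (induction cs arbitrary: x y)
  case (Cons c cs)
  have "T (x + y) - c *\<^sub>C (x + y) = (T x - c *\<^sub>C x) + (T y - c *\<^sub>C y)"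
    by (simp add: bounded_clinear_simps[OF T] scaleC_simps)
  with mult_left_mono[OF Cons a, of "T x - c *\<^sub>C x" "T y - c *\<^sub>C y"] norm_triangle_ineq[of x y]
  show ?case by (simp add: distrib_left)
qed simp

lemma flag_norm_le_norm:
  assumes T: "bounded_clinear T" and a: "0 \<le> a"
  shows "\<exists>K>0. \<forall>x. flag_norm T a cs x \<le> K * norm x"
proof (induction cs)
  case (Cons c cs)
  then obtain K where K: "0 < K" "\<And>x. flag_norm T a cs x \<le> K * norm x" by blast
  obtain M where M: "0 < M" "\<And>x. norm (T x - c *\<^sub>C x) \<le> norm x * M"
    using bounded_linear.pos_bounded[OF bounded_clinear_imp_bounded_linear[OF
          bounded_clinear_sub_scale[OF T bounded_clinear_id]]] by blast
  have "flag_norm T a (c # cs) x \<le> (1 + a * (K * M)) * norm x" for x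
  proof -
    have "flag_norm T a cs (T x - c *\<^sub>C x) \<le> K * (norm x * M)"
      using K(2) mult_left_mono[OF M(2)] K(1) by (meson less_imp_le order_trans)
    from mult_left_mono[OF this a] show ?thesis by (simp add: algebra_simps)
  qed
  moreover have "0 < 1 + a * (K * M)" using K M a by (simp add: add_pos_nonneg)
  ultimately show ?case by blast
qed (auto intro: exI[of _ 1])

text \<open>
  Since $T x_i = c_{i+1} x_i + x_{i+1}$ and $x_m = 0$, applying $T$ multiplies the $i$-th term by
  at most $|c_{i+1}|$ and adds $a^i \|x_{i+1}\|$, which is $1/a$ times the next term. The first
  term is not the successor of any other, so $\|x\|$ may be subtracted; this sharper form is what
  the induction needs.
\<close>

lemma flag_norm_contracts:
  assumes T: "bounded_clinear T" and a: "0 < a"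
    and "\<And>c. c \<in> set cs \<Longrightarrow> cmod c \<le> \<rho>" and "lin_factors T cs x = 0"
  shows "flag_norm T a cs (T x) \<le> \<rho> * flag_norm T a cs x + (flag_norm T a cs x - norm x) / a"
  using assms(3,4)
proof (induction cs arbitrary: x)
  case Nil
  then show ?case by simp
next
  case (Cons c cs)
  define y where "y = T x - c *\<^sub>C x"
  let ?A = "flag_norm T a cs y"
  have Tx: "T x = c *\<^sub>C x + y" by (simp add: y_def)
  have "T (T x) - c *\<^sub>C T x = T y"
    by (simp add: y_def bounded_clinear_simps[OF T])
  moreover have "flag_norm T a cs (T y) \<le> \<rho> * ?A + (?A - norm y) / a"
    using Cons by (simp add: y_def)
  ultimately have 1: "a * flag_norm T a cs (T (T x) - c *\<^sub>C T x) \<le> a * \<rho> * ?A + (?A - norm y)"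
    using mult_left_mono[of "flag_norm T a cs (T y)" "\<rho> * ?A + (?A - norm y) / a" a] a
    by (simp add: distrib_left mult.assoc)
  have "norm (T x) \<le> cmod c * norm x + norm y"
    unfolding Tx using norm_triangle_ineq[of "c *\<^sub>C x" y] by (simp add: norm_scaleC)
  also have "\<dots> \<le> \<rho> * norm x + norm y"
    using Cons.prems(1)[of c] by (simp add: mult_right_mono)
  finally have "flag_norm T a (c # cs) (T x) \<le> \<rho> * norm x + a * \<rho> * ?A + ?A"
    using 1 by simp
  then show ?case using a by (simp add: y_def[symmetric] algebra_simps)
qed

lemma adapted_norm_exists:
  fixes T :: "'a::complex_banach \<Rightarrow> 'a"
  assumes T: "bounded_clinear T" and ann: "\<And>x. lin_factors T cs x = 0"
    and disc: "\<And>c. c \<in> set cs \<Longrightarrow> cmod c < 1"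
  shows "\<exists>N lam K. adapted_norm T N lam K"
proof -
  define \<rho> where "\<rho> = Max (insert 0 (cmod ` set cs))"
  have \<rho>: "0 \<le> \<rho>" "\<rho> < 1" "\<And>c. c \<in> set cs \<Longrightarrow> cmod c \<le> \<rho>"
    using disc by (auto simp: \<rho>_def)
  \<comment> \<open>With this weight the factor \<open>\<rho> + 1 / a\<close> equals \<open>(1 + \<rho>) / 2\<close>, which is below 1.\<close>
  define a where "a = 2 / (1 - \<rho>)"
  have a: "0 < a" "1 / a = (1 - \<rho>) / 2" using \<rho> by (auto simp: a_def)
  obtain K where K: "0 < K" "\<And>x. flag_norm T a cs x \<le> K * norm x"
    using flag_norm_le_norm[OF T, of a cs] a by auto
  have "flag_norm T a cs (T x) \<le> (1 + \<rho>) / 2 * flag_norm T a cs x" for x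
  proof -
    let ?n = "flag_norm T a cs x"
    have "flag_norm T a cs (T x) \<le> \<rho> * ?n + (?n - norm x) / a"
      using flag_norm_contracts[OF T a(1) \<rho>(3) ann] .
    also have "\<dots> \<le> \<rho> * ?n + ?n * (1 / a)"
      using a(1) by (simp add: divide_right_mono)
    also have "\<dots> = (1 + \<rho>) / 2 * ?n" unfolding a(2) by (simp add: field_simps)
    finally show ?thesis .
  qed
  then have "adapted_norm T (flag_norm T a cs) ((1 + \<rho>) / 2) K"
    using \<rho> a K flag_norm_triangle[OF T] norm_le_flag_norm[OF _ ann]
    by (intro adapted_norm.intro bounded_clinear_imp_bounded_linear[OF T]) auto
  then show ?thesis by blast
qed

section \<open>Shadowing for contractions and expansions\<close>

lemma iter_int_orbit:
  assumes "bij f" "\<And>n. z (n + 1) = f (z n)"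
  shows "iter_int f n (z 0) = z n"
proof -
  have "(f ^^ k) (z 0) = z (int k)" for k
    by (induction k) (simp_all add: assms(2)[symmetric] add.commute)
  moreover have "(inv f ^^ k) (z 0) = z (- int k)" for k
  proof (induction k)
    case (Suc k)
    have "z (- int k) = f (z (- int (Suc k)))"
      using assms(2)[of "- int (Suc k)"] by simp
    then show ?case using Suc assms(1) by (simp add: bij_is_inj)
  qed simp
  ultimately show ?thesis by (simp add: iter_int_def)
qed

context adapted_norm
begin

lemma N_funpow: "N ((T ^^ j) x) \<le> lam ^ j * N x"
proof (induction j)
  case (Suc j)
  have "N ((T ^^ Suc j) x) \<le> lam * N ((T ^^ j) x)" using N_contracts by simp
  also have "\<dots> \<le> lam * (lam ^ j * N x)" using Suc lam_nonneg by (rule mult_left_mono)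
  finally show ?case by simp
qed simp

text \<open>
  The bound \<open>\<eta> \<le> 1 - lam\<close> makes \<open>max 1 (N (u n))\<close> decreasing in \<open>n\<close>: a point
  outside the unit ball of \<open>N\<close> is contracted by at least as much as the error can push it out,
  and a point inside stays inside. So all errors up to time \<open>n\<close> are at most
  \<open>\<eta> (max 1 (N (u n)))\<close>, and so is, up to the factor $1/(1 - lam)$, the sum of their images
  at time \<open>n\<close>.
\<close>

lemma orbit_near_sequence:
  fixes u :: "int \<Rightarrow> 'a"
  assumes \<eta>: "antimono \<eta>" "\<And>t. \<eta> t \<le> 1 - lam"
    and err: "\<And>n. N (u n - T (u (n - 1))) \<le> \<eta> (max 1 (N (u n)))"
  shows "\<exists>w. (\<forall>n. w n = T (w (n - 1))) \<and>
    (\<forall>n. norm (u n - w n) \<le> \<eta> (max 1 (N (u n))) / (1 - lam))"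
proof -
  interpret T: bounded_linear T by (rule bounded_linear_T)
  define s where "s n = max 1 (N (u n))" for n
  define d where "d n = u n - T (u (n - 1))" for n
  have d: "N (d n) \<le> \<eta> (s n)" for n
    using err by (simp add: d_def s_def)
  have s_step: "s n \<le> s (n - 1)" for n
  proof -
    have "N (u n) \<le> N (d n) + N (T (u (n - 1)))"
      using N_triangle[of "d n" "T (u (n - 1))"] by (simp add: d_def)
    also have "\<dots> \<le> (1 - lam) + lam * N (u (n - 1))"
      using d[of n] \<eta>(2)[of "s n"] N_contracts[of "u (n - 1)"] by linarith
    also have "\<dots> \<le> (1 - lam) * s (n - 1) + lam * s (n - 1)"
      using lam_nonneg lam_less_1
      by (intro add_mono mult_left_mono) (auto simp: s_def)
    also have "\<dots> = s (n - 1)" by (simp add: algebra_simps)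
    finally show ?thesis by (simp add: s_def)
  qed
  have s_past: "s n \<le> s (n - int j)" for n j
  proof (induction j)
    case (Suc j)
    have "s (n - int j) \<le> s (n - int (Suc j))"
      using s_step[of "n - int j"] by (simp add: algebra_simps)
    with Suc show ?case by simp
  qed simp
  \<comment> \<open>The error made at time \<open>n - j\<close>, transported to time \<open>n\<close>.\<close>
  define t where "t n j = (T ^^ j) (d (n - int j))" for n j
  have t_le: "norm (t n j) \<le> \<eta> (s n) * lam ^ j" for n j
  proof -
    have "norm (t n j) \<le> lam ^ j * N (d (n - int j))"
      unfolding t_def by (rule order_trans[OF norm_le_N N_funpow])
    also have "\<dots> \<le> lam ^ j * \<eta> (s n)"
      using d[of "n - int j"] antimonoD[OF \<eta>(1) s_past[of n j]] lam_nonneg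
      by (intro mult_left_mono) auto
    finally show ?thesis by (simp add: mult.commute)
  qed
  have geo: "summable (\<lambda>j. \<eta> (s n) * lam ^ j)" for n
    using lam_nonneg lam_less_1 by (intro summable_mult summable_geometric) simp
  have t_sum: "summable (t n)" for n
    using summable_comparison_test'[OF geo t_le] .
  define e where "e n = suminf (t n)" for n
  have e_le: "norm (e n) \<le> \<eta> (s n) / (1 - lam)" for n
  proof -
    have "norm (e n) \<le> (\<Sum>j. \<eta> (s n) * lam ^ j)"
      unfolding e_def by (rule norm_suminf_le[OF t_le geo])
    also have "\<dots> = \<eta> (s n) / (1 - lam)"
      using lam_nonneg lam_less_1
      by (subst suminf_mult) (auto simp: suminf_geometric summable_geometric)
    finally show ?thesis .
  qed
  have e_rec: "e n = d n + T (e (n - 1))" for n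
  proof -
    have "t n (Suc j) = T (t (n - 1) j)" for j
      by (simp add: t_def algebra_simps)
    then have "(\<Sum>j. t n (Suc j)) = T (e (n - 1))"
      by (simp add: e_def T.suminf[OF t_sum])
    then show ?thesis
      using suminf_split_head[OF t_sum[of n]] by (simp add: e_def t_def)
  qed
  show ?thesis
  proof (intro exI[of _ "\<lambda>n. u n - e n"] conjI allI)
    show "u n - e n = T (u (n - 1) - e (n - 1))" for n
      using e_rec[of n] by (simp add: d_def T.diff)
    show "norm (u n - (u n - e n)) \<le> \<eta> (max 1 (N (u n))) / (1 - lam)" for n
      using e_le[of n] by (simp add: s_def)
  qed
qed

text \<open>
  The choice of \<open>\<delta>\<close> common to contractions and expansions. The point \<open>x\<close> at which the
  error is measured is left open, since it is \<open>T (u (n - 1))\<close> for a contraction and the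
  \<open>T\<close>-preimage of \<open>u n\<close> for an expansion; it only has to be nearly as far out as \<open>u n\<close>.
\<close>

lemma shadowing_radius:
  assumes cpt: "\<And>R. compact (cball (0::'a) R)" and \<epsilon>: "\<epsilon> \<in> pos_continuous"
  obtains \<delta> where "\<delta> \<in> pos_continuous"
    "\<And>x. K * \<delta> x \<le> 1"
    "\<And>u :: int \<Rightarrow> 'a. (\<And>n. \<exists>x. max 1 (N (u n)) \<le> N x + 1 \<and> N (u n - T (u (n - 1))) \<le> K * \<delta> x)
      \<Longrightarrow> \<exists>w. (\<forall>n. w n = T (w (n - 1))) \<and> (\<forall>n. dist (w n) (u n) < \<epsilon> (w n))"
proof -
  obtain G where G: "continuous_on UNIV G" "antimono G" "\<And>t. 0 < G t" "\<And>t. G t \<le> 1 / 2"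
    "\<And>t y. norm y \<le> t + 1 \<Longrightarrow> G t < \<epsilon> y"
    using radial_minorant[OF cpt \<epsilon>] by blast
  define \<eta> where "\<eta> t = (1 - lam) * G t" for t
  have \<eta>_anti: "antimono \<eta>"
    using G(2) lam_less_1 by (auto simp: \<eta>_def antimono_def intro!: mult_left_mono)
  have \<eta>_le: "\<eta> t \<le> 1 - lam" for t
    using mult_left_mono[of "G t" 1 "1 - lam"] G(4)[of t] lam_less_1 by (simp add: \<eta>_def)
  define \<delta> where "\<delta> x = \<eta> (K * norm x + 1) / K" for x :: 'a
  show ?thesis
  proof (rule that[of \<delta>])
    have "continuous_on UNIV \<delta>"
      unfolding \<delta>_def \<eta>_def using K_pos
      by (intro continuous_intros continuous_on_compose2[OF G(1)]) auto
    then show "\<delta> \<in> pos_continuous"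
      using G(3) K_pos lam_less_1 by (auto simp: pos_continuous_def \<delta>_def \<eta>_def)
    show "K * \<delta> x \<le> 1" for x
      using \<eta>_le[of "K * norm x + 1"] K_pos lam_nonneg by (simp add: \<delta>_def)
  next
    fix u :: "int \<Rightarrow> 'a"
    assume u: "\<And>n. \<exists>x. max 1 (N (u n)) \<le> N x + 1 \<and> N (u n - T (u (n - 1))) \<le> K * \<delta> x"
    have "N (u n - T (u (n - 1))) \<le> \<eta> (max 1 (N (u n)))" for n
    proof -
      obtain x where x: "max 1 (N (u n)) \<le> N x + 1" "N (u n - T (u (n - 1))) \<le> K * \<delta> x"
        using u by blast
      have "K * \<delta> x = \<eta> (K * norm x + 1)" using K_pos by (simp add: \<delta>_def)
      also have "\<dots> \<le> \<eta> (max 1 (N (u n)))"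
        using x(1) N_le_norm[of x] by (intro antimonoD[OF \<eta>_anti]) linarith
      finally show ?thesis using x(2) by linarith
    qed
    from orbit_near_sequence[of \<eta> u, OF \<eta>_anti \<eta>_le this] obtain w
      where w: "\<And>n. w n = T (w (n - 1))"
        "\<And>n. norm (u n - w n) \<le> \<eta> (max 1 (N (u n))) / (1 - lam)"
      by blast
    have "dist (w n) (u n) < \<epsilon> (w n)" for n
    proof -
      let ?s = "max 1 (N (u n))"
      have close: "norm (u n - w n) \<le> G ?s"
        using w(2)[of n] lam_less_1 by (simp add: \<eta>_def)
      have "norm (w n) \<le> norm (u n) + norm (u n - w n)"
        using norm_triangle_ineq4[of "u n" "u n - w n"] by simp
      also have "\<dots> \<le> ?s + 1"
        using norm_le_N[of "u n"] close G(4)[of ?s] by linarith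
      finally have "G ?s < \<epsilon> (w n)" by (rule G(5))
      with close show ?thesis by (simp add: dist_norm norm_minus_commute)
    qed
    with w(1) show "\<exists>w. (\<forall>n. w n = T (w (n - 1))) \<and> (\<forall>n. dist (w n) (u n) < \<epsilon> (w n))"
      by blast
  qed
qed

theorem contraction_shadowing:
  assumes cpt: "\<And>R. compact (cball (0::'a) R)" and "bij T"
  shows "topological_shadowing T"
  unfolding topological_shadowing_def
proof (rule ballI)
  fix \<epsilon> :: "'a \<Rightarrow> real" assume "\<epsilon> \<in> pos_continuous"
  then obtain \<delta> where \<delta>: "\<delta> \<in> pos_continuous" "\<And>x. K * \<delta> x \<le> 1"
    "\<And>u :: int \<Rightarrow> 'a. (\<And>n. \<exists>x. max 1 (N (u n)) \<le> N x + 1 \<and> N (u n - T (u (n - 1))) \<le> K * \<delta> x)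
      \<Longrightarrow> \<exists>w. (\<forall>n. w n = T (w (n - 1))) \<and> (\<forall>n. dist (w n) (u n) < \<epsilon> (w n))"
    using shadowing_radius[OF cpt] by blast
  have "shadowed T \<epsilon> x" if "pseudo_orbit T \<delta> x" for x
  proof -
    have "max 1 (N (x n)) \<le> N (T (x (n - 1))) + 1 \<and>
        N (x n - T (x (n - 1))) \<le> K * \<delta> (T (x (n - 1)))" for n
    proof -
      have "norm (x n - T (x (n - 1))) \<le> \<delta> (T (x (n - 1)))"
        using that[unfolded pseudo_orbit_def, rule_format, of "n - 1"]
        by (simp add: dist_norm norm_minus_commute)
      then have 1: "N (x n - T (x (n - 1))) \<le> K * \<delta> (T (x (n - 1)))"
        using N_le_norm[of "x n - T (x (n - 1))"] K_pos
        by (meson mult_left_mono less_imp_le order_trans)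
      moreover have "N (x n) \<le> N (x n - T (x (n - 1))) + N (T (x (n - 1)))"
        using N_triangle[of "x n - T (x (n - 1))" "T (x (n - 1))"] by simp
      moreover have "0 \<le> N (T (x (n - 1)))"
        by (rule order_trans[OF norm_ge_zero norm_le_N])
      ultimately show ?thesis using \<delta>(2)[of "T (x (n - 1))"] by auto
    qed
    then obtain w where w: "\<And>n. w n = T (w (n - 1))" "\<And>n. dist (w n) (x n) < \<epsilon> (w n)"
      using \<delta>(3)[of x] by blast
    have "iter_int T n (w 0) = w n" for n
      by (rule iter_int_orbit[OF assms(2)]) (use w(1) in \<open>metis add_diff_cancel_right'\<close>)
    with w(2) show ?thesis unfolding shadowed_def by metis
  qed
  with \<delta>(1) show "\<exists>\<delta>\<in>pos_continuous. \<forall>x. pseudo_orbit T \<delta> x \<longrightarrow> shadowed T \<epsilon> x" by blast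
qed

text \<open>
  A pseudo orbit of \<open>L\<close> read backwards is a pseudo orbit of the contraction \<open>T\<close>, where
  the error \<open>L (x n) - x (n + 1)\<close> turns into its image under \<open>T\<close>, which is no larger.
\<close>

theorem expansion_shadowing:
  assumes cpt: "\<And>R. compact (cball (0::'a) R)"
    and inv: "\<And>x. T (L x) = x" "\<And>x. L (T x) = x"
  shows "topological_shadowing L"
  unfolding topological_shadowing_def
proof (rule ballI)
  interpret T: bounded_linear T by (rule bounded_linear_T)
  have "bij L" by (rule o_bij[of T]) (auto simp: inv fun_eq_iff)
  fix \<epsilon> :: "'a \<Rightarrow> real" assume "\<epsilon> \<in> pos_continuous"
  then obtain \<delta> where \<delta>: "\<delta> \<in> pos_continuous" "\<And>x. K * \<delta> x \<le> 1"
    "\<And>u :: int \<Rightarrow> 'a. (\<And>n. \<exists>x. max 1 (N (u n)) \<le> N x + 1 \<and> N (u n - T (u (n - 1))) \<le> K * \<delta> x)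
      \<Longrightarrow> \<exists>w. (\<forall>n. w n = T (w (n - 1))) \<and> (\<forall>n. dist (w n) (u n) < \<epsilon> (w n))"
    using shadowing_radius[OF cpt] by blast
  have N_nonneg: "0 \<le> N x" for x by (rule order_trans[OF norm_ge_zero norm_le_N])
  have N_T: "N (T x) \<le> N x" for x
    using N_contracts[of x] mult_right_mono[of lam 1 "N x"] lam_less_1 N_nonneg[of x] by simp
  have "shadowed L \<epsilon> x" if "pseudo_orbit L \<delta> x" for x
  proof -
    let ?u = "\<lambda>n::int. x (- n)"
    have "max 1 (N (?u n)) \<le> N (L (?u n)) + 1 \<and>
        N (?u n - T (?u (n - 1))) \<le> K * \<delta> (L (?u n))" for n
    proof -
      have "norm (L (?u n) - ?u (n - 1)) \<le> \<delta> (L (?u n))"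
        using that[unfolded pseudo_orbit_def, rule_format, of "- n"]
        by (simp add: dist_norm)
      then have "N (L (?u n) - ?u (n - 1)) \<le> K * \<delta> (L (?u n))"
        using N_le_norm[of "L (?u n) - ?u (n - 1)"] K_pos
        by (meson mult_left_mono less_imp_le order_trans)
      moreover have "?u n - T (?u (n - 1)) = T (L (?u n) - ?u (n - 1))"
        by (simp add: T.diff inv)
      moreover have "N (?u n) \<le> N (L (?u n))" using N_T[of "L (?u n)"] by (simp add: inv)
      ultimately show ?thesis
        using N_T[of "L (?u n) - ?u (n - 1)"] N_nonneg[of "L (?u n)"] by auto
    qed
    then obtain w where w: "\<And>n. w n = T (w (n - 1))" "\<And>n. dist (w n) (?u n) < \<epsilon> (w n)"
      using \<delta>(3)[of ?u] by blast
    have "iter_int L n (w (- 0)) = w (- n)" for n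
    proof (rule iter_int_orbit[OF \<open>bij L\<close>, of "\<lambda>n. w (- n)"])
      show "w (- (n + 1)) = L (w (- n))" for n
        using w(1)[of "- n"] by (simp add: inv)
    qed
    moreover have "dist (w (- n)) (x n) < \<epsilon> (w (- n))" for n
      using w(2)[of "- n"] by simp
    ultimately show ?thesis unfolding shadowed_def by metis
  qed
  with \<delta>(1) show "\<exists>\<delta>\<in>pos_continuous. \<forall>x. pseudo_orbit L \<delta> x \<longrightarrow> shadowed L \<epsilon> x" by blast
qed

end

section \<open>Obstructions to shadowing\<close>

lemma iter_int_Suc:
  assumes "bij f"
  shows "iter_int f (n + 1) y = f (iter_int f n y)"
proof (cases "0 \<le> n")
  case True
  then show ?thesis by (simp add: iter_int_def nat_add_distrib)
next
  case False
  then obtain k where k: "n = - int (Suc k)"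
    by (metis int_cases not_less_eq_eq negative_zle of_nat_0_le_iff)
  then have 1: "nat (- (n + 1)) = k" "nat (- n) = Suc k" by simp_all
  have "f (iter_int f n y) = (inv f ^^ k) y"
    using False 1 assms by (simp add: iter_int_def bij_is_surj surj_f_inv_f)
  also have "\<dots> = iter_int f (n + 1) y"
    using False 1 by (cases k) (auto simp: iter_int_def)
  finally show ?thesis by simp
qed

lemma iter_int_of_nat: "iter_int f (int m) y = (f ^^ m) y"
  by (simp add: iter_int_def)

lemma funpow_iter_int_neg:
  assumes "bij f"
  shows "(f ^^ m) (iter_int f (- int m) y) = y"
proof (induction m)
  case (Suc m)
  have "f (iter_int f (- int (Suc m)) y) = iter_int f (- int m) y"
    using iter_int_Suc[OF assms, of "- int (Suc m)" y] by simp
  then show ?case using Suc by (simp add: funpow_swap1)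
qed (simp add: iter_int_def)

lemma bounded_clinear_funpow:
  fixes T :: "'a::complex_normed_vector \<Rightarrow> 'a"
  assumes "bounded_clinear T"
  shows "bounded_clinear (T ^^ m)"
proof (induction m)
  case 0
  show ?case using bounded_clinear_id by (simp add: id_def)
next
  case (Suc m)
  then show ?case using bounded_clinear_compose[OF assms] by (simp add: o_def)
qed

lemma funpow_eigenvector:
  assumes "bounded_clinear T" "T v = a *\<^sub>C v"
  shows "(T ^^ m) v = a ^ m *\<^sub>C v"
  by (induction m) (simp_all add: assms(2) bounded_clinear_simps[OF assms(1)] scaleC_simps mult.commute)

text \<open>
  On the generalized eigenspace of a modulus-one eigenvalue \<open>a\<close>, bounded forward orbits consist of
  genuine eigenvectors: if $(T - a)^2 q = 0$ and $p = (T - a) q$, then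
  $T^m q = a^m q + m a^{m-1} p$, which is bounded only for $p = 0$. The product over the other
  roots projects onto this eigenspace, up to an invertible factor. The induction
  over the list of roots removes the factors \<open>T - a\<close> one at a time.
\<close>

lemma bounded_orbit_peripheral:
  assumes T: "bounded_clinear T" and a: "cmod a = 1"
    and "lin_factors T cs y = 0" and "\<And>m. norm ((T ^^ m) y) \<le> B"
  shows "T (lin_factors T (filter (\<lambda>c. c \<noteq> a) cs) y)
    = a *\<^sub>C lin_factors T (filter (\<lambda>c. c \<noteq> a) cs) y"
  using assms(3,4)
proof (induction cs arbitrary: y B)
  case Nil
  then show ?case by (simp add: bounded_clinear_simps[OF T] scaleC_simps)
next
  case (Cons c cs)
  let ?F = "lin_factors T (filter (\<lambda>c. c \<noteq> a) cs)"
  have F: "bounded_clinear ?F" by (rule bounded_clinear_lin_factors[OF T])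
  note Tm = bounded_clinear_funpow[OF T]
  have "norm ((T ^^ m) (T y - c *\<^sub>C y)) \<le> B + cmod c * B" for m
  proof -
    have "(T ^^ m) (T y - c *\<^sub>C y) = (T ^^ Suc m) y - c *\<^sub>C (T ^^ m) y"
      by (simp add: bounded_clinear_simps[OF Tm] funpow_swap1)
    then show ?thesis
      using norm_triangle_ineq4[of "(T ^^ Suc m) y" "c *\<^sub>C (T ^^ m) y"]
        Cons.prems(2)[of "Suc m"] mult_left_mono[OF Cons.prems(2)[of m], of "cmod c"]
      by (simp add: norm_scaleC del: funpow.simps)
  qed
  then have IH: "T (?F (T y - c *\<^sub>C y)) = a *\<^sub>C ?F (T y - c *\<^sub>C y)"
    using Cons.IH[of "T y - c *\<^sub>C y" "B + cmod c * B"] Cons.prems(1) by simp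
  show ?case
  proof (cases "c = a")
    case False
    then show ?thesis using IH by simp
  next
    case True
    define q p where "q = ?F y" and "p = T q - a *\<^sub>C q"
    have "?F (T y - c *\<^sub>C y) = p"
      using lin_factors_commute[OF T, of T "filter (\<lambda>c. c \<noteq> a) cs" y]
      by (simp add: p_def q_def True bounded_clinear_simps[OF F])
    with IH have Tp: "T p = a *\<^sub>C p" by simp
    have Tq: "T q = a *\<^sub>C q + p" by (simp add: p_def)
    obtain M where M: "0 < M" "\<And>x. norm (?F x) \<le> norm x * M"
      using bounded_linear.pos_bounded[OF bounded_clinear_imp_bounded_linear[OF F]] by blast
    have orbit: "(T ^^ Suc m) q = a ^ Suc m *\<^sub>C q + (of_nat (Suc m) * a ^ m) *\<^sub>C p" for m
    proof (induction m)
      case 0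
      then show ?case by (simp add: Tq scaleC_simps)
    next
      case (Suc m)
      have "(T ^^ Suc (Suc m)) q = T ((T ^^ Suc m) q)" by simp
      also have "\<dots> = a ^ Suc m *\<^sub>C T q + (of_nat (Suc m) * a ^ m) *\<^sub>C T p"
        unfolding Suc by (simp only: bounded_clinear_simps[OF T])
      also have "\<dots> = a ^ Suc (Suc m) *\<^sub>C q
          + (a ^ Suc m + of_nat (Suc m) * a ^ m * a) *\<^sub>C p"
        unfolding Tp Tq by (simp add: scaleC_add_right scaleC_add_left scaleC_scaleC mult.commute)
      also have "a ^ Suc m + of_nat (Suc m) * a ^ m * a = of_nat (Suc (Suc m)) * a ^ Suc m"
        by (simp add: algebra_simps)
      finally show ?case .
    qed
    have growth: "real (Suc m) * norm p \<le> B * M + norm q" for m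
    proof -
      have "(T ^^ Suc m) q = ?F ((T ^^ Suc m) y)"
        unfolding q_def
        by (rule lin_factors_commute[OF Tm]) (simp add: funpow_swap1)
      then have "norm ((T ^^ Suc m) q) \<le> norm ((T ^^ Suc m) y) * M" using M(2) by simp
      also have "\<dots> \<le> B * M" using M(1) by (intro mult_right_mono Cons.prems(2)) auto
      finally have 1: "norm ((T ^^ Suc m) q) \<le> B * M" .
      have 2: "norm (a ^ Suc m *\<^sub>C q) = norm q"
        by (simp add: norm_scaleC norm_mult norm_power a)
      have "real (Suc m) * norm p = norm ((of_nat (Suc m) * a ^ m) *\<^sub>C p)"
        by (simp only: norm_scaleC norm_mult norm_power a norm_of_nat) simp
      also have "(of_nat (Suc m) * a ^ m) *\<^sub>C p = (T ^^ Suc m) q - a ^ Suc m *\<^sub>C q"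
        unfolding orbit by simp
      also have "norm \<dots> \<le> norm ((T ^^ Suc m) q) + norm (a ^ Suc m *\<^sub>C q)"
        by (rule norm_triangle_ineq4)
      also have "\<dots> \<le> B * M + norm q" unfolding 2 using 1 by (rule add_right_mono)
      finally show ?thesis .
    qed
    have "p = 0"
    proof (rule ccontr)
      assume "p \<noteq> 0"
      then obtain m :: nat where "B * M + norm q < real m * norm p"
        using reals_Archimedean3[of "norm p"] by auto
      moreover have "real m * norm p \<le> real (Suc m) * norm p" by (intro mult_right_mono) auto
      ultimately show False using growth[of m] by linarith
    qed
    then show ?thesis using True by (simp add: p_def q_def[symmetric])
  qed
qed

text \<open>
  Let \<open>F\<close> be the product over the roots different from \<open>a\<close>. A shadowing orbit of a bounded
  pseudo orbit is bounded, so its image under \<open>F\<close> is an orbit of constant norm. That norm is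
  at most $\|F\|$, because the pseudo orbit starts at 0. But when the pseudo orbit has drifted to
  $R v$, the image under \<open>F\<close> has norm at least $R\,|k|\,\|v\| - \|F\|$, where \<open>F v = k v\<close>
  and $k \ne 0$.
\<close>

theorem neutral_eigenvalue_no_shadowing:
  fixes L :: "'a::complex_normed_vector \<Rightarrow> 'a"
  assumes L: "bounded_clinear L" and "bij L" and ann: "\<And>x. lin_factors L cs x = 0"
    and v: "L v = a *\<^sub>C v" "v \<noteq> 0" and a: "cmod a = 1"
  shows "\<not> topological_shadowing L"
proof
  assume "topological_shadowing L"
  moreover have "(\<lambda>x::'a. 1::real) \<in> pos_continuous" by (simp add: pos_continuous_def)
  ultimately obtain \<delta> where \<delta>: "\<delta> \<in> pos_continuous"
    and sh: "\<And>x. pseudo_orbit L \<delta> x \<Longrightarrow> shadowed L (\<lambda>x. 1) x"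
    unfolding topological_shadowing_def by blast
  let ?ds = "filter (\<lambda>c. c \<noteq> a) cs"
  let ?F = "lin_factors L ?ds"
  have F: "bounded_clinear ?F" by (rule bounded_clinear_lin_factors[OF L])
  obtain M where M: "0 < M" "\<And>x. norm (?F x) \<le> norm x * M"
    using bounded_linear.pos_bounded[OF bounded_clinear_imp_bounded_linear[OF F]] by blast
  define k where "k = (\<Prod>d\<leftarrow>?ds. a - d)"
  have k: "k \<noteq> 0" by (auto simp: k_def prod_list_zero_iff)
  have Fv: "?F v = k *\<^sub>C v" unfolding k_def by (rule lin_factors_eigenvector[OF L v(1)])
  define R where "R = (2 * M + 1) / (cmod k * norm v)"
  have R: "0 < R" "R * (cmod k * norm v) = 2 * M + 1"
    using M(1) k v(2) by (simp_all add: R_def add_pos_pos)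
  \<comment> \<open>The drift stays in this compact set, so \<open>\<delta>\<close> has a positive lower bound \<open>\<delta>0\<close> along it.\<close>
  let ?D = "(\<lambda>c. c *\<^sub>C v) ` cball 0 R"
  have "compact ?D"
    by (intro compact_continuous_image compact_cball
        bounded_linear.continuous_on[OF bounded_linear_scaleC_left continuous_on_id])
  moreover have "?D \<noteq> {}" using R by simp
  moreover have "continuous_on ?D \<delta>"
    using \<delta> by (auto simp: pos_continuous_def intro: continuous_on_subset)
  ultimately obtain w where "\<forall>y\<in>?D. \<delta> w \<le> \<delta> y"
    using continuous_attains_inf by blast
  then obtain \<delta>0 where \<delta>0: "0 < \<delta>0" "\<And>c. cmod c \<le> R \<Longrightarrow> \<delta>0 \<le> \<delta> (c *\<^sub>C v)"
    using \<delta> that[of "\<delta> w"] by (auto simp: pos_continuous_def)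
  define h where "h = \<delta>0 / (2 * norm v)"
  have h: "0 < h" "h * norm v < \<delta>0" using \<delta>0(1) v(2) by (simp_all add: h_def)
  \<comment> \<open>The ramp of the drift: 0 up to time 0, then steps \<open>h\<close> until \<open>R\<close> is reached.\<close>
  define r where "r n = min R (max 0 (h * of_int n))" for n :: int
  have r: "0 \<le> r n" "r n \<le> R" for n using R by (auto simp: r_def)
  have r_step: "\<bar>r n - r (n + 1)\<bar> \<le> h" for n
    using h(1) R(1) unfolding r_def by (simp add: distrib_left)
  have r_neg: "r n = 0" if "n \<le> 0" for n
    using that h(1) R(1) by (simp add: r_def mult_nonneg_nonpos)
  define x where "x n = (of_real (r n) * a ^ nat n) *\<^sub>C v" for n
  have Lx: "L (x n) = (of_real (r n) * a ^ nat n * a) *\<^sub>C v" for n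
    by (simp add: x_def bounded_clinear_simps[OF L] v(1) scaleC_scaleC)
  have "pseudo_orbit L \<delta> x"
    unfolding pseudo_orbit_def
  proof
    fix n
    have "\<delta>0 \<le> \<delta> (L (x n))"
      unfolding Lx using r[of n] by (intro \<delta>0(2)) (simp add: norm_mult norm_power a)
    moreover have "dist (L (x n)) (x (n + 1)) \<le> h * norm v"
    proof (cases "0 \<le> n")
      case True
      then have "L (x n) - x (n + 1) = (of_real (r n - r (n + 1)) * (a ^ nat n * a)) *\<^sub>C v"
        unfolding Lx unfolding x_def
        by (simp add: nat_add_distrib algebra_simps
            flip: complex_vector.scale_left_diff_distrib)
      then have "dist (L (x n)) (x (n + 1)) = \<bar>r n - r (n + 1)\<bar> * norm v"
        by (simp only: dist_norm norm_scaleC norm_mult norm_power a norm_of_real) simp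
      then show ?thesis using r_step[of n] by (simp add: mult_right_mono)
    next
      case False
      then have "L (x n) = 0" "x (n + 1) = 0"
        unfolding Lx unfolding x_def by (simp_all add: r_neg)
      then show ?thesis using h(1) by simp
    qed
    ultimately show "dist (L (x n)) (x (n + 1)) < \<delta> (L (x n))" using h(2) by linarith
  qed
  from sh[OF this] obtain y where y: "\<And>n. dist (iter_int L n y) (x n) < 1"
    unfolding shadowed_def by blast
  have y_nat: "norm ((L ^^ m) y - x (int m)) < 1" for m
    using y[of "int m"] by (simp add: iter_int_of_nat dist_norm)
  have "norm ((L ^^ m) y) \<le> 1 + R * norm v" for m
  proof -
    have "norm (x (int m)) \<le> R * norm v"
      using r[of "int m"]
      by (simp add: x_def norm_scaleC norm_mult norm_power a mult_right_mono)
    then show ?thesis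
      using y_nat[of m] norm_triangle_sub[of "(L ^^ m) y" "x (int m)"] by linarith
  qed
  then have "L (?F y) = a *\<^sub>C ?F y"
    by (rule bounded_orbit_peripheral[OF L a ann])
  note Fy = funpow_eigenvector[OF L this]
  have "norm y < 1" using y_nat[of 0] by (simp add: x_def r_neg)
  then have Fy_le: "norm (?F y) \<le> M"
    using M(2)[of y] mult_right_mono[of "norm y" 1 M] M(1) by linarith
  obtain m :: nat where "R / h < real m" using reals_Archimedean2 by blast
  then have rm: "r (int m) = R" using h R by (simp add: r_def field_simps)
  have "?F ((L ^^ m) y - x (int m)) = a ^ m *\<^sub>C (?F y - (of_real R * k) *\<^sub>C v)"
  proof -
    have "?F ((L ^^ m) y) = a ^ m *\<^sub>C ?F y"
      unfolding Fy[symmetric]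
      by (rule lin_factors_commute[OF bounded_clinear_funpow[OF L], symmetric])
        (simp add: funpow_swap1)
    moreover have "?F (x (int m)) = a ^ m *\<^sub>C ((of_real R * k) *\<^sub>C v)"
      by (simp add: x_def rm bounded_clinear_simps[OF F] Fv scaleC_scaleC mult_ac)
    ultimately show ?thesis
      by (simp add: bounded_clinear_simps[OF F] complex_vector.scale_right_diff_distrib)
  qed
  then have "norm (?F y - (of_real R * k) *\<^sub>C v) = norm (?F ((L ^^ m) y - x (int m)))"
    by (simp add: norm_scaleC norm_power a)
  also have "\<dots> \<le> M"
    using M(2)[of "(L ^^ m) y - x (int m)"] M(1) y_nat[of m]
      mult_right_mono[of "norm ((L ^^ m) y - x (int m))" 1 M] by linarith
  finally have "norm ((of_real R * k) *\<^sub>C v) \<le> 2 * M"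
    using Fy_le norm_triangle_ineq4[of "?F y" "?F y - (of_real R * k) *\<^sub>C v"] by simp
  moreover have "norm ((of_real R * k) *\<^sub>C v) = 2 * M + 1"
    using R by (simp add: norm_scaleC norm_mult mult.assoc)
  ultimately show False by simp
qed

text \<open>
  The points of the incoming branch grow like $|b|^{-m}$ as time $-m$ recedes, so the tolerance
  $\exp(-\|x\|)$ there is doubly exponentially small. It beats the at most exponential growth of
  $L^m$, by which any deviation at time $-m$ is carried to time 0.
\<close>

theorem saddle_no_shadowing:
  fixes L :: "'a::complex_normed_vector \<Rightarrow> 'a"
  assumes L: "bounded_clinear L" and "bij L"
    and w: "L w = b *\<^sub>C w" "w \<noteq> 0" "cmod b < 1"
    and v: "L v = a *\<^sub>C v" "v \<noteq> 0" "1 < cmod a"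
  shows "\<not> topological_shadowing L"
proof
  assume "topological_shadowing L"
  moreover have "(\<lambda>x::'a. exp (- norm x)) \<in> pos_continuous"
    by (auto simp: pos_continuous_def intro!: continuous_intros)
  ultimately obtain \<delta> where \<delta>: "\<delta> \<in> pos_continuous"
    and sh: "\<And>x. pseudo_orbit L \<delta> x \<Longrightarrow> shadowed L (\<lambda>x. exp (- norm x)) x"
    unfolding topological_shadowing_def by blast
  note Lm = bounded_clinear_funpow[OF L]
  have \<delta>_pos: "0 < \<delta> y" for y using \<delta> by (auto simp: pos_continuous_def)
  have "b \<noteq> 0"
    using w \<open>bij L\<close> bounded_clinear_zero[OF L]
    by (metis bij_pointE complex_vector.scale_zero_left)
  define r where "r = 1 / cmod b"
  have r: "1 < r" using \<open>b \<noteq> 0\<close> w(3) by (simp add: r_def)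
  \<comment> \<open>The jump from \<open>L w\<close>, in the unstable direction and of size half the allowed error.\<close>
  define p where "p = (\<delta> (L w) / (2 * norm v)) *\<^sub>R v"
  have p: "norm p < \<delta> (L w)" "p \<noteq> 0"
    using \<delta>_pos[of "L w"] v(2) by (simp_all add: p_def)
  have Lp: "L p = a *\<^sub>C p"
    by (simp add: p_def v(1) bounded_clinear_scale[OF L] scaleC_scaleC mult.commute
        flip: scaleC_of_real)
  define W where "W n = iter_int L n w" for n
  define x where "x n = W n + (if 1 \<le> n then (L ^^ nat (n - 1)) p else 0)" for n
  have LW: "L (W n) = W (n + 1)" for n
    unfolding W_def by (rule iter_int_Suc[OF \<open>bij L\<close>, symmetric])
  have "pseudo_orbit L \<delta> x"
    unfolding pseudo_orbit_def
  proof
    fix n :: int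
    consider "n < 0" | "n = 0" | "1 \<le> n" by linarith
    then show "dist (L (x n)) (x (n + 1)) < \<delta> (L (x n))"
    proof cases
      case 1
      then show ?thesis using \<delta>_pos by (simp add: x_def LW)
    next
      case 2
      have "W 0 = w" by (simp add: W_def iter_int_def)
      then show ?thesis using 2 p(1) LW[of 0] by (simp add: x_def dist_norm)
    next
      case 3
      then have "nat n = Suc (nat (n - 1))" by simp
      then have "L (x n) = x (n + 1)"
        using 3 by (simp add: x_def bounded_clinear_simps[OF L] LW)
      then show ?thesis using \<delta>_pos by simp
    qed
  qed
  from sh[OF this] obtain y
    where y: "\<And>n. dist (iter_int L n y) (x n) < exp (- norm (iter_int L n y))"
    unfolding shadowed_def by blast
  obtain K where K: "0 < K" "\<And>x. norm (L x) \<le> norm x * K"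
    using bounded_linear.pos_bounded[OF bounded_clinear_imp_bounded_linear[OF L]] by blast
  \<comment> \<open>Enlarged beyond 1 so that \<open>M0 ^ m\<close> has a definite asymptotic behaviour.\<close>
  define M0 where "M0 = K + 1"
  have M0: "1 < M0" "\<And>x. norm (L x) \<le> norm x * M0"
    using K(1) order_trans[OF K(2) mult_left_mono[of K M0]] by (simp_all add: M0_def)
  have funpow_le: "norm ((L ^^ m) z) \<le> M0 ^ m * norm z" for m z
  proof (induction m)
    case (Suc m)
    have "norm ((L ^^ Suc m) z) \<le> norm ((L ^^ m) z) * M0" using M0(2) by simp
    also have "\<dots> \<le> (M0 ^ m * norm z) * M0" using Suc M0(1) by (intro mult_right_mono) auto
    finally show ?case by (simp add: mult_ac)
  qed simp
  have "norm (y - w) \<le> M0 ^ m * exp (1 - r ^ m * norm w)" for m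
  proof -
    let ?y = "iter_int L (- int m) y"
    have Wm: "(L ^^ m) (W (- int m)) = w"
      unfolding W_def by (rule funpow_iter_int_neg[OF \<open>bij L\<close>])
    have "(L ^^ m) ((inverse b ^ m) *\<^sub>C w) = w"
      using \<open>b \<noteq> 0\<close>
      by (simp add: bounded_clinear_simps[OF Lm] funpow_eigenvector[OF L w(1)] scaleC_simps
          flip: power_mult_distrib)
    then have "W (- int m) = (inverse b ^ m) *\<^sub>C w"
      using Wm bij_is_inj[OF \<open>bij L\<close>] inj_fn[of L m] by (metis injD)
    then have "norm (W (- int m)) = r ^ m * norm w"
      by (simp add: norm_scaleC norm_power norm_divide r_def inverse_eq_divide)
    moreover have close: "norm (?y - W (- int m)) < exp (- norm ?y)"
      using y[of "- int m"] by (simp add: x_def dist_norm)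
    moreover have "exp (- norm ?y) \<le> 1" by simp
    ultimately have "r ^ m * norm w - 1 \<le> norm ?y"
      using norm_triangle_sub[of "W (- int m)" ?y] norm_minus_commute[of ?y "W (- int m)"]
      by linarith
    with close have "norm (?y - W (- int m)) \<le> exp (1 - r ^ m * norm w)"
      by (smt (verit) exp_le_cancel_iff)
    moreover have "y - w = (L ^^ m) (?y - W (- int m))"
      by (simp add: bounded_clinear_simps[OF Lm] Wm funpow_iter_int_neg[OF \<open>bij L\<close>])
    ultimately show ?thesis
      using funpow_le[of m "?y - W (- int m)"] M0(1)
      by (smt (verit) mult_left_mono zero_le_power)
  qed
  moreover have "(\<lambda>m. M0 ^ m * exp (1 - r ^ m * norm w)) \<longlonglongrightarrow> 0"
    using M0(1) r w(2)[folded zero_less_norm_iff] by real_asymp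
  ultimately have "norm (y - w) \<le> 0"
    by (intro LIMSEQ_le_const) auto
  then have "y = w" by simp
  have "cmod a ^ m * norm p < 1" for m
  proof -
    have "dist (W (int (Suc m))) (x (int (Suc m))) < 1"
      using y[of "int (Suc m)"] \<open>y = w\<close> unfolding W_def
      by (smt (verit) exp_le_one_iff norm_ge_zero)
    then show ?thesis
      by (simp add: x_def dist_norm funpow_eigenvector[OF L Lp] norm_scaleC norm_power)
  qed
  moreover obtain m where "1 / norm p < cmod a ^ m"
    using real_arch_pow[OF v(3)] by blast
  ultimately show False using p(2) by (simp add: field_simps) (metis less_asym mult.commute)
qed

section \<open>The characterization\<close>

theorem theoremA:
  fixes L :: "'a::complex_banach \<Rightarrow> 'a"
  assumes fin_dim: "\<exists>B::'a set. finite B \<and> cspan B = UNIV"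
    and nontrivial: "0 < cdim (UNIV :: 'a set)"
    and L: "invertible_op L"
  shows "topological_shadowing L \<longleftrightarrow>
           spectrum L \<subseteq> ball 0 1 \<or> spectrum L \<subseteq> - closure (ball 0 1)"
proof -
  obtain B :: "'a set" where B: "finite B" "cspan B = UNIV" using fin_dim by blast
  obtain S where lin: "bounded_clinear L" and S: "bounded_clinear S"
    and inv: "\<And>x. S (L x) = x" "\<And>x. L (S x) = x"
    using invertible_opE[OF L] by metis
  have "bij L" by (rule o_bij[of S]) (auto simp: inv fun_eq_iff)
  have cpt: "compact (cball (0::'a) R)" for R
    using compact_cspan_cball[OF B(1)] B(2) by simp
  have adapted: "\<exists>N lam K. adapted_norm T N lam K"
    if T: "bounded_clinear T" and disc: "spectrum T \<subseteq> ball 0 1" for T :: "'a \<Rightarrow> 'a"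
  proof -
    obtain cs where cs: "\<And>x. lin_factors T cs x = 0"
      using lin_factors_annihilates[OF T B] by blast
    have "lin_factors T (filter (\<lambda>c. c \<in> spectrum T) cs) x = 0" for x
      by (rule lin_factors_filter_eq_0[OF T _ cs]) (use eigenvalue_in_spectrum in blast)
    then show ?thesis
      by (rule adapted_norm_exists[OF T]) (use disc in auto)
  qed
  obtain cs where cs: "\<And>x. lin_factors L cs x = 0" using lin_factors_annihilates[OF lin B] by blast
  show ?thesis
  proof
    assume "spectrum L \<subseteq> ball 0 1 \<or> spectrum L \<subseteq> - closure (ball 0 1)"
    then show "topological_shadowing L"
    proof
      assume "spectrum L \<subseteq> ball 0 1"
      then show ?thesis
        using adapted[OF lin] adapted_norm.contraction_shadowing[OF _ cpt \<open>bij L\<close>] by blast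
    next
      assume ext: "spectrum L \<subseteq> - closure (ball 0 1)"
      obtain ds where ds: "\<And>x. lin_factors S ds x = 0" using lin_factors_annihilates[OF S B] by blast
      have "spectrum S \<subseteq> ball 0 1"
      proof
        fix c assume "c \<in> spectrum S"
        then obtain x where x: "x \<noteq> 0" "S x = c *\<^sub>C x"
          using spectrum_imp_eigenvalue[OF S ds] by blast
        then have "x = c *\<^sub>C L x" using inv(2)[of x] bounded_clinear_scale[OF lin] by metis
        with x(1) have "c \<noteq> 0" by (metis complex_vector.scale_zero_left)
        have "inverse c *\<^sub>C x = inverse c *\<^sub>C (c *\<^sub>C L x)"
          using \<open>x = c *\<^sub>C L x\<close> by (rule arg_cong)
        with \<open>c \<noteq> 0\<close> have "L x = inverse c *\<^sub>C x"
          by (simp add: scaleC_scaleC scaleC_one)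
        then have "inverse c \<in> - closure (ball 0 1)"
          using ext eigenvalue_in_spectrum[of L x] x(1) by blast
        then show "c \<in> ball 0 1"
          using \<open>c \<noteq> 0\<close> by (simp add: norm_inverse one_less_inverse_iff not_le)
      qed
      then show ?thesis
        using adapted[OF S] adapted_norm.expansion_shadowing[OF _ cpt inv] by blast
    qed
  next
    assume shadowing: "topological_shadowing L"
    show "spectrum L \<subseteq> ball 0 1 \<or> spectrum L \<subseteq> - closure (ball 0 1)"
    proof (rule ccontr)
      assume "\<not> ?thesis"
      then obtain a b where ab: "a \<in> spectrum L" "1 \<le> cmod a" "b \<in> spectrum L" "cmod b \<le> 1"
        by (auto simp: subset_iff not_less)
      obtain v where v: "v \<noteq> 0" "L v = a *\<^sub>C v"
        using spectrum_imp_eigenvalue[OF lin cs ab(1)] by blast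
      obtain w where w: "w \<noteq> 0" "L w = b *\<^sub>C w"
        using spectrum_imp_eigenvalue[OF lin cs ab(3)] by blast
      have "cmod a \<noteq> 1" "cmod b \<noteq> 1"
        using neutral_eigenvalue_no_shadowing[OF lin \<open>bij L\<close> cs] v w shadowing by blast+
      with ab show False
        using saddle_no_shadowing[OF lin \<open>bij L\<close> w(2,1) _ v(2,1)] shadowing by simp
    qed
  qed
qed

end
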